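(* Fix $k_d\in(-\sqrt2,0)$. For $k_f>0$ sufficiently small let $\Omega(k_f)$ be the billiard table with two polygonal spirals joining into a regular double spiral, constructed as in the context. Then $\Omega(k_f)$ is contained in a bounded region of the plane independent of $k_f$: there is a bounded set $B\subset\mathbb R^2$ such that $\Omega(k_f)\subset B$ for all sufficiently small $k_f>0$.
   Context: **Bulk of the table.** Given $h>0$, $k_d\in(-\sqrt2,0)$, $k_f>0$: take the unit square $[0,1]\times[h,1+h]$ and replace its left, upper and right sides by circular minor arcs of radius $1/|k_d|$ with the same endpoints, bulging towards the inside of the square; the union of these three dispersing arcs is $\Gamma_d$. Below it is the rectangle $[0,1]\times[0,h]$ (its horizontal sides are not walls). $\Gamma_f$ is the focusing circular minor arc of radius $1/k_f$ with endpoints $(0,0)$ and $(1,0)$, bulging downward; the region between $[0,1]\times\{0\}$ and $\Gamma_f$ belongs to the table. The union of these regions is the bulk; it has two openings, the segments $\{0\}\times[0,h]$ and $\{1\}\times[0,h]$. **Optimal constants.** For $s\in\Gamma_d\cup\Gamma_f$ with curvature $k(s)$ ($=k_d$ on $\Gamma_d$, $=k_f$ on $\Gamma_f$) and $\beta>0$ (resp. $\beta<0$), $D_\beta(s)$ is the closed disc of radius $1/|\beta k(s)|$ tangent to the boundary at $s$ on the internal (resp. external) side of the table. For $s'\in\Gamma_d$, $s''\in\Gamma_f$, $I(s',s'')$ is the intersection of the line through $s',s''$ with $D_{-2}(s')$. For $k_f$ small, $h_o=h_o(k_f)=\min\{h>0:\forall s'\in\Gamma_d,\forall s''\in\Gamma_f,\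 I(s',s'')\subset D_4(s'')\}$ and $l_o=1/k_f$. **Polygonal spirals.** To each opening is attached a polygonal spiral, a union of adjacent right trapezoids $T_1,\dots,T_N$. The perpendicular (shorter) leg of $T_1$ is the opening, of length $h_1:=h$. The shorter base of $T_i$ has length $l_i$, its nonright angles are $\pi/2+\gamma_i$ (adjacent to the shorter base) and $\pi/2-\gamma_i$, $0<\gamma_i<\pi/2$; hence its slanted leg has length $h_{i+1}:=h_i/\cos\gamma_i$. The slanted leg of $T_i$ is the perpendicular leg of $T_{i+1}$, and the shorter base of $T_{i+1}$ begins where the shorter base of $T_i$ ends. Both spirals turn counterclockwise at each corner and have no self-intersections, nor intersections with each other or with the bulk (sharing boundary is allowed). Parameters of the right and left spirals carry the superscript $\epsilon=R,L$. $\Omega(k_f)$ is the union of the bulk and the two spirals. **Initial sections.** There are fixed integers $m^R,m^L$ and fixed angles $\gamma_i^\epsilon$ ($1\le i<m^\epsilon$), rational multiples of $\pi$, all independent of $k_f$, such that the two spirals become adjacent at their trapezoids $T^R_{m^R}$ and $T^L_{m^L}$, where they join into a regular double spiral wrapping around the bulk and around the initial sections $T_i^\epsilon$, $i<m^\epsilon$. Put $K_4=\prod_{i<m^R}(\cos\gamma_i^R)^{-1}+\prod_{i<m^L}(\cos\gamma_i^L)^{-1}$. **Regular double spiral.** All trapezoids $T_i^\epsilon$ with $i\ge m^\epsilon$ have $\gamma_i^\epsilon=\bar\gamma:=2\pi/\bar N$, $\bar N$ an integer. The double spiral has a center $A$ (a fixed point) and an initial ray $r_0$, a constant independent of $k_f$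 and large enough to avoid intersections with the bulk: the perpendicular legs of $T^R_{m^R}$ and $T^L_{m^L}$ lie one after the other on a half-line from $A$, at distances from $A$ in $[r_0,r_0+h^R_{m^R}]$ and $[r_0+h^R_{m^R},r_0+w_0]$, where $w_0=h^R_{m^R}+h^L_{m^L}=K_4h$; moreover $l^R_{m^R}=r_0\tan\bar\gamma$ and $l^L_{m^L}=(r_0+h^R_{m^R})\tan\bar\gamma$. At each turn the picture rotates about $A$ by $\bar\gamma$ and all distances from $A$ are multiplied by $1/\cos\bar\gamma$. The spiral wraps around itself tightly: $w_0=r_0\big((\cos\frac{2\pi}{\bar N})^{-\bar N}-1\big)$, i.e. $$h=\frac{r_0}{K_4}\Big(\big(\cos\tfrac{2\pi}{\bar N}\big)^{-\bar N}-1\Big),$$ and, given $k_f$, the integer $\bar N=\bar N(k_f)$ (and thus $h=h(k_f)$) is chosen so that $h_o\le h\le 2h_o$. The double spiral makes $M=\left[\frac{1}{2\pi r_0k_f}\right]+1$ complete rounds ($[\cdot]$ is the integer part), i.e. $N^\epsilon=m^\epsilon+M\bar N$. *)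

theory Defs
  imports "HOL-Analysis.Analysis"
begin

text \<open>The Euclidean plane is \<open>complex\<close>; \<open>Complex x y\<close> is the point with coordinates \<open>(x, y)\<close>.\<close>

section \<open>Circular arcs and the bulk of the table\<close>

definition left_side :: "complex \<Rightarrow> complex \<Rightarrow> complex set" where
  "left_side a b = {z. 0 \<le> Im (cnj (b - a) * (z - a))}"

text \<open>Centre of the circle of radius \<open>\<rho>\<close> through \<open>a\<close> and \<open>b\<close> that lies on the right of the
  oriented chord from \<open>a\<close> to \<open>b\<close>, so that the part of the circle on the left of the chord is the
  minor arc.\<close>
definition arc_center :: "real \<Rightarrow> complex \<Rightarrow> complex \<Rightarrow> complex" where
  "arc_center \<rho> a b =
     (a + b) / 2 - \<i> * sgn (b - a) * complex_of_real (sqrt (\<rho>\<^sup>2 - (dist a b / 2)\<^sup>2))"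

definition minor_arc :: "real \<Rightarrow> complex \<Rightarrow> complex \<Rightarrow> complex set" where
  "minor_arc \<rho> a b = sphere (arc_center \<rho> a b) \<rho> \<inter> left_side a b"

text \<open>Left, upper and right side of the unit square \<open>[0,1] \<times> [h,1+h]\<close>, oriented so that the square
  is on their left: the arcs on these chords bulge towards the inside of the square.\<close>
definition square_sides :: "real \<Rightarrow> (complex \<times> complex) set" where
  "square_sides h =
     {(Complex 0 (1 + h), Complex 0 h),
      (Complex 1 (1 + h), Complex 0 (1 + h)),
      (Complex 1 h, Complex 1 (1 + h))}"

text \<open>Centre of the focusing arc; its chord is oriented from \<open>(1,0)\<close> to \<open>(0,0)\<close>, hence the arc
  bulges downward.\<close>
definition focusing_center :: "real \<Rightarrow> complex" where
  "focusing_center kf = arc_center (1 / kf) (Complex 1 0) (Complex 0 0)"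

definition focusing_arc :: "real \<Rightarrow> complex set" where
  "focusing_arc kf = minor_arc (1 / kf) (Complex 1 0) (Complex 0 0)"

text \<open>The dispersing region is the square minus the (open) discs of the three arcs; the last piece is
  the circular segment between \<open>[0,1] \<times> {0}\<close> and the focusing arc.\<close>
definition bulk :: "real \<Rightarrow> real \<Rightarrow> real \<Rightarrow> complex set" where
  "bulk kd kf h =
     (cbox (Complex 0 h) (Complex 1 (1 + h))
        - (\<Union>(a, b)\<in>square_sides h. ball (arc_center (1 / \<bar>kd\<bar>) a b) (1 / \<bar>kd\<bar>)))
     \<union> cbox (Complex 0 0) (Complex 1 h)
     \<union> (cball (focusing_center kf) (1 / kf) \<inter> left_side (Complex 1 0) (Complex 0 0))"

section \<open>The optimal height\<close>

text \<open>The disc \<open>D\<^sub>\<beta>(s)\<close> at a point \<open>s\<close> of a boundary arc with centre \<open>c\<close> and signed curvature \<open>k\<close>.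
  The inner unit normal of the table at \<open>s\<close> is \<open>sgn k *\<^sub>R sgn (c - s)\<close> (towards \<open>c\<close> on a focusing arc,
  away from \<open>c\<close> on a dispersing one), and the centre of the disc is at signed distance
  \<open>1 / (\<beta> * \<bar>k\<bar>)\<close> from \<open>s\<close> along it.\<close>
definition tangent_disc :: "real \<Rightarrow> real \<Rightarrow> complex \<Rightarrow> complex \<Rightarrow> complex set" where
  "tangent_disc \<beta> k c s =
     cball (s + (1 / (\<beta> * \<bar>k\<bar>)) *\<^sub>R (sgn k *\<^sub>R sgn (c - s))) (1 / \<bar>\<beta> * k\<bar>)"

text \<open>At a common endpoint of two dispersing arcs the condition is imposed for both tangent discs.\<close>
definition focusing_condition :: "real \<Rightarrow> real \<Rightarrow> real \<Rightarrow> bool" where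
  "focusing_condition kd kf h \<longleftrightarrow>
     (\<forall>(a, b)\<in>square_sides h. \<forall>s'\<in>minor_arc (1 / \<bar>kd\<bar>) a b. \<forall>s''\<in>focusing_arc kf.
        affine hull {s', s''} \<inter> tangent_disc (-2) kd (arc_center (1 / \<bar>kd\<bar>) a b) s'
          \<subseteq> tangent_disc 4 kf (focusing_center kf) s'')"

definition h_opt :: "real \<Rightarrow> real \<Rightarrow> real" where
  "h_opt kd kf = (LEAST h. 0 < h \<and> focusing_condition kd kf h)"

section \<open>Polygonal spirals\<close>

datatype side = Rgt | Lft

text \<open>In this section \<open>h\<close> is the length of the openings, and \<open>\<gamma> \<epsilon> i\<close>, \<open>l \<epsilon> i\<close> (\<open>i \<ge> 1\<close>) are the angle
  and the length of the shorter base of the \<open>i\<close>-th trapezoid of the spiral on the side \<open>\<epsilon>\<close>.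

  \<open>heading\<close> is the unit direction of the parallel bases, pointing away from the perpendicular leg.
  Turning counterclockwise means that the shorter base is the one on the left when looking in that
  direction. \<open>near_vertex\<close> is the endpoint of the perpendicular leg on the shorter base, \<open>far_vertex\<close>
  the one on the longer base. The right spiral leaves its opening \<open>{1} \<times> [0,h]\<close> eastward, so its first
  near vertex is \<open>(1,h)\<close>; the left one leaves \<open>{0} \<times> [0,h]\<close> westward, starting from the near vertex
  \<open>(0,0)\<close>.\<close>

definition heading :: "(side \<Rightarrow> nat \<Rightarrow> real) \<Rightarrow> side \<Rightarrow> nat \<Rightarrow> complex" where
  "heading \<gamma> \<epsilon> i = (case \<epsilon> of Rgt \<Rightarrow> 1 | Lft \<Rightarrow> - 1) * cis (\<Sum>j=1..<i. \<gamma> \<epsilon> j)"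

definition leg_length :: "real \<Rightarrow> (side \<Rightarrow> nat \<Rightarrow> real) \<Rightarrow> side \<Rightarrow> nat \<Rightarrow> real" where
  "leg_length h \<gamma> \<epsilon> i = h * (\<Prod>j=1..<i. 1 / cos (\<gamma> \<epsilon> j))"

definition near_vertex ::
  "real \<Rightarrow> (side \<Rightarrow> nat \<Rightarrow> real) \<Rightarrow> (side \<Rightarrow> nat \<Rightarrow> real) \<Rightarrow> side \<Rightarrow> nat \<Rightarrow> complex" where
  "near_vertex h \<gamma> l \<epsilon> i =
     (case \<epsilon> of Rgt \<Rightarrow> Complex 1 h | Lft \<Rightarrow> Complex 0 0) + (\<Sum>j=1..<i. l \<epsilon> j *\<^sub>R heading \<gamma> \<epsilon> j)"

definition far_vertex ::
  "real \<Rightarrow> (side \<Rightarrow> nat \<Rightarrow> real) \<Rightarrow> (side \<Rightarrow> nat \<Rightarrow> real) \<Rightarrow> side \<Rightarrow> nat \<Rightarrow> complex" where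
  "far_vertex h \<gamma> l \<epsilon> i =
     near_vertex h \<gamma> l \<epsilon> i - leg_length h \<gamma> \<epsilon> i *\<^sub>R (\<i> * heading \<gamma> \<epsilon> i)"

definition trapezoid ::
  "real \<Rightarrow> (side \<Rightarrow> nat \<Rightarrow> real) \<Rightarrow> (side \<Rightarrow> nat \<Rightarrow> real) \<Rightarrow> side \<Rightarrow> nat \<Rightarrow> complex set" where
  "trapezoid h \<gamma> l \<epsilon> i =
     convex hull
       {near_vertex h \<gamma> l \<epsilon> i,
        near_vertex h \<gamma> l \<epsilon> i + l \<epsilon> i *\<^sub>R heading \<gamma> \<epsilon> i,
        far_vertex h \<gamma> l \<epsilon> i
          + (l \<epsilon> i + leg_length h \<gamma> \<epsilon> i * tan (\<gamma> \<epsilon> i)) *\<^sub>R heading \<gamma> \<epsilon> i,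
        far_vertex h \<gamma> l \<epsilon> i}"

text \<open>The slanted leg of each trapezoid is the perpendicular leg of the next one.\<close>
lemma near_vertex_Suc:
  assumes "1 \<le> i"
  shows "near_vertex h \<gamma> l \<epsilon> (Suc i) = near_vertex h \<gamma> l \<epsilon> i + l \<epsilon> i *\<^sub>R heading \<gamma> \<epsilon> i"
  using assms by (simp add: near_vertex_def)

lemma far_vertex_Suc:
  assumes "1 \<le> i" "cos (\<gamma> \<epsilon> i) \<noteq> 0"
  shows "far_vertex h \<gamma> l \<epsilon> (Suc i) =
    far_vertex h \<gamma> l \<epsilon> i + (l \<epsilon> i + leg_length h \<gamma> \<epsilon> i * tan (\<gamma> \<epsilon> i)) *\<^sub>R heading \<gamma> \<epsilon> i"
proof -
  define g e p H where "g = \<gamma> \<epsilon> i" and "e = heading \<gamma> \<epsilon> i"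
    and "p = near_vertex h \<gamma> l \<epsilon> i" and "H = leg_length h \<gamma> \<epsilon> i"
  have 1: "heading \<gamma> \<epsilon> (Suc i) = e * cis g"
    using assms by (simp add: heading_def cis_mult e_def g_def)
  have 2: "leg_length h \<gamma> \<epsilon> (Suc i) = H / cos g"
    using assms by (simp add: leg_length_def H_def g_def)
  have "cos g \<noteq> 0"
    using assms by (simp add: g_def)
  then show ?thesis
    unfolding far_vertex_def near_vertex_Suc[OF assms(1)] 1 2
    unfolding g_def[symmetric] e_def[symmetric] p_def[symmetric] H_def[symmetric]
    by (simp add: complex_eq_iff tan_def field_simps)
qed

section \<open>The double spiral and the table\<close>

text \<open>\<open>m \<epsilon>\<close> is the index of the first regular trapezoid of the spiral \<open>\<epsilon>\<close>, \<open>\<gamma> \<epsilon> i\<close> (\<open>1 \<le> i < m \<epsilon>\<close>)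
  are the angles of the initial sections, \<open>N\<close> is the number of turns in a round.\<close>

definition full_angles :: "(side \<Rightarrow> nat) \<Rightarrow> (side \<Rightarrow> nat \<Rightarrow> real) \<Rightarrow> nat \<Rightarrow> side \<Rightarrow> nat \<Rightarrow> real" where
  "full_angles m \<gamma> N \<epsilon> i = (if i < m \<epsilon> then \<gamma> \<epsilon> i else 2 * pi / real N)"

definition K4 :: "(side \<Rightarrow> nat) \<Rightarrow> (side \<Rightarrow> nat \<Rightarrow> real) \<Rightarrow> real" where
  "K4 m \<gamma> = (\<Prod>i=1..<m Rgt. 1 / cos (\<gamma> Rgt i)) + (\<Prod>i=1..<m Lft. 1 / cos (\<gamma> Lft i))"

definition opening_length :: "real \<Rightarrow> (side \<Rightarrow> nat) \<Rightarrow> (side \<Rightarrow> nat \<Rightarrow> real) \<Rightarrow> nat \<Rightarrow> real" where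
  "opening_length r0 m \<gamma> N = r0 / K4 m \<gamma> * ((1 / cos (2 * pi / real N)) ^ N - 1)"

definition rounds :: "real \<Rightarrow> real \<Rightarrow> nat" where
  "rounds r0 kf = nat \<lfloor>1 / (2 * pi * r0 * kf)\<rfloor> + 1"

definition last_index :: "real \<Rightarrow> real \<Rightarrow> (side \<Rightarrow> nat) \<Rightarrow> nat \<Rightarrow> side \<Rightarrow> nat" where
  "last_index kf r0 m N \<epsilon> = m \<epsilon> + rounds r0 kf * N"

definition spiral_piece ::
  "real \<Rightarrow> (side \<Rightarrow> nat) \<Rightarrow> (side \<Rightarrow> nat \<Rightarrow> real) \<Rightarrow> nat \<Rightarrow> (side \<Rightarrow> nat \<Rightarrow> real)
     \<Rightarrow> side \<Rightarrow> nat \<Rightarrow> complex set" where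
  "spiral_piece r0 m \<gamma> N l = trapezoid (opening_length r0 m \<gamma> N) (full_angles m \<gamma> N) l"

definition table ::
  "real \<Rightarrow> real \<Rightarrow> real \<Rightarrow> (side \<Rightarrow> nat) \<Rightarrow> (side \<Rightarrow> nat \<Rightarrow> real) \<Rightarrow> nat
     \<Rightarrow> (side \<Rightarrow> nat \<Rightarrow> real) \<Rightarrow> complex set" where
  "table kd kf r0 m \<gamma> N l =
     bulk kd kf (opening_length r0 m \<gamma> N)
     \<union> (\<Union>\<epsilon>. \<Union>i\<in>{1..last_index kf r0 m N \<epsilon>}. spiral_piece r0 m \<gamma> N l \<epsilon> i)"

definition regular_part ::
  "real \<Rightarrow> real \<Rightarrow> (side \<Rightarrow> nat) \<Rightarrow> (side \<Rightarrow> nat \<Rightarrow> real) \<Rightarrow> nat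
     \<Rightarrow> (side \<Rightarrow> nat \<Rightarrow> real) \<Rightarrow> complex set" where
  "regular_part kf r0 m \<gamma> N l =
     (\<Union>\<epsilon>. \<Union>i\<in>{m \<epsilon>..last_index kf r0 m N \<epsilon>}. spiral_piece r0 m \<gamma> N l \<epsilon> i)"

definition non_overlapping ::
  "real \<Rightarrow> real \<Rightarrow> real \<Rightarrow> (side \<Rightarrow> nat) \<Rightarrow> (side \<Rightarrow> nat \<Rightarrow> real) \<Rightarrow> nat
     \<Rightarrow> (side \<Rightarrow> nat \<Rightarrow> real) \<Rightarrow> bool" where
  "non_overlapping kd kf r0 m \<gamma> N l \<longleftrightarrow>
     disjoint_family_on (\<lambda>(\<epsilon>, i). interior (spiral_piece r0 m \<gamma> N l \<epsilon> i))
       (SIGMA \<epsilon>:UNIV. {1..last_index kf r0 m N \<epsilon>})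
     \<and> (\<forall>\<epsilon>. \<forall>i\<in>{1..last_index kf r0 m N \<epsilon>}.
          interior (spiral_piece r0 m \<gamma> N l \<epsilon> i) \<inter> interior (bulk kd kf (opening_length r0 m \<gamma> N)) = {})"

text \<open>\<open>v\<close> is the direction of the half-line from the centre \<open>A\<close> carrying the perpendicular legs of the
  two first regular trapezoids.\<close>
definition regular_double_spiral ::
  "real \<Rightarrow> complex \<Rightarrow> real \<Rightarrow> (side \<Rightarrow> nat) \<Rightarrow> (side \<Rightarrow> nat \<Rightarrow> real) \<Rightarrow> nat
     \<Rightarrow> (side \<Rightarrow> nat \<Rightarrow> real) \<Rightarrow> bool" where
  "regular_double_spiral kf A r0 m \<gamma> N l \<longleftrightarrow>
     (let h = opening_length r0 m \<gamma> N; g = full_angles m \<gamma> N; \<theta> = 2 * pi / real N;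
          hR = leg_length h g Rgt (m Rgt); hL = leg_length h g Lft (m Lft)
      in (\<exists>v. norm v = 1
            \<and> near_vertex h g l Rgt (m Rgt) = A + r0 *\<^sub>R v
            \<and> far_vertex h g l Rgt (m Rgt) = A + (r0 + hR) *\<^sub>R v
            \<and> near_vertex h g l Lft (m Lft) = A + (r0 + hR) *\<^sub>R v
            \<and> far_vertex h g l Lft (m Lft) = A + (r0 + hR + hL) *\<^sub>R v)
         \<and> l Rgt (m Rgt) = r0 * tan \<theta>
         \<and> l Lft (m Lft) = (r0 + hR) * tan \<theta>
         \<and> (\<forall>\<epsilon>. \<forall>i\<in>{m \<epsilon>..<last_index kf r0 m N \<epsilon>}.
              spiral_piece r0 m \<gamma> N l \<epsilon> (Suc i) =
                (\<lambda>z. A + (1 / cos \<theta>) *\<^sub>R (cis \<theta> * (z - A))) ` spiral_piece r0 m \<gamma> N l \<epsilon> i))"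

text \<open>Since boundary points may be shared, it is the interiors of the bulk and of the initial
  trapezoids that are surrounded by the regular part.\<close>
definition wraps_around ::
  "real \<Rightarrow> real \<Rightarrow> real \<Rightarrow> (side \<Rightarrow> nat) \<Rightarrow> (side \<Rightarrow> nat \<Rightarrow> real) \<Rightarrow> nat
     \<Rightarrow> (side \<Rightarrow> nat \<Rightarrow> real) \<Rightarrow> bool" where
  "wraps_around kd kf r0 m \<gamma> N l \<longleftrightarrow>
     interior (bulk kd kf (opening_length r0 m \<gamma> N)) \<subseteq> inside (regular_part kf r0 m \<gamma> N l)
     \<and> (\<forall>\<epsilon>. \<forall>i\<in>{1..<m \<epsilon>}.
          interior (spiral_piece r0 m \<gamma> N l \<epsilon> i) \<subseteq> inside (regular_part kf r0 m \<gamma> N l))"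

definition double_spiral_table ::
  "real \<Rightarrow> real \<Rightarrow> complex \<Rightarrow> real \<Rightarrow> (side \<Rightarrow> nat) \<Rightarrow> (side \<Rightarrow> nat \<Rightarrow> real) \<Rightarrow> nat
     \<Rightarrow> (side \<Rightarrow> nat \<Rightarrow> real) \<Rightarrow> bool" where
  "double_spiral_table kd kf A r0 m \<gamma> N l \<longleftrightarrow>
     0 < 2 * pi / real N \<and> 2 * pi / real N < pi / 2
     \<and> h_opt kd kf \<le> opening_length r0 m \<gamma> N \<and> opening_length r0 m \<gamma> N \<le> 2 * h_opt kd kf
     \<and> (\<forall>\<epsilon>. \<forall>i\<in>{1..last_index kf r0 m N \<epsilon>}. 0 < l \<epsilon> i)
     \<and> regular_double_spiral kf A r0 m \<gamma> N l
     \<and> wraps_around kd kf r0 m \<gamma> N l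
     \<and> non_overlapping kd kf r0 m \<gamma> N l"

end

theory Submission
  imports Defs
begin

text \<open>One round of the double spiral multiplies distances from the centre by \<open>1 + K\<^sub>4 h / r\<^sub>0\<close>, so
  \<open>M\<close> rounds multiply them by at most \<open>exp (M K\<^sub>4 h / r\<^sub>0)\<close>. Since \<open>M\<close> is of order \<open>1 / k\<^sub>f\<close>, everything
  rests on \<open>h\<^sub>o = O(k\<^sub>f)\<close>: within a bounded distance of \<open>s''\<close>, the boundary of the disc \<open>D\<^sub>4(s'')\<close>,
  whose radius is \<open>1 / (4 k\<^sub>f)\<close>, rises by at most a multiple of \<open>k\<^sub>f\<close>, so already a height of order
  \<open>k\<^sub>f\<close> lifts every chord \<open>I(s', s'')\<close> into it. That the minimum defining \<open>h\<^sub>o\<close> is attained (otherwise \<open>LEAST\<close> would be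
  unspecified) follows because the admissible heights are at least \<open>k\<^sub>f\<close> and form a closed set.\<close>

section \<open>The boundary arcs\<close>

lemma arc_center_unit_chord:
  assumes "norm (b - a) = 1"
  shows "arc_center \<rho> a b = (a + b) / 2 - \<i> * (b - a) * complex_of_real (sqrt (\<rho>\<^sup>2 - 1/4))"
proof -
  have "sgn (b - a) = b - a"
    using assms by (simp add: sgn_div_norm)
  moreover have "dist a b = 1"
    using assms by (simp add: dist_norm norm_minus_commute)
  ultimately show ?thesis
    by (simp add: arc_center_def power2_eq_square)
qed

lemma square_side_chord: "(a, b) \<in> square_sides h \<Longrightarrow> norm (b - a) = 1"
  by (auto simp: square_sides_def cmod_def)

text \<open>Raising the square is a vertical translation. This lets the three arcs be indexed by the
  fixed set \<open>square_sides 0\<close>, so that later \<open>h\<close> occurs only in the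
  inequalities and not in the range of the quantifiers.\<close>

lemma square_sides_translate:
  "square_sides h = (\<lambda>(a, b). (a + Complex 0 h, b + Complex 0 h)) ` square_sides 0"
  by (simp add: square_sides_def complex_add add.commute)

lemma arc_center_translate: "arc_center \<rho> (a + v) (b + v) = arc_center \<rho> a b + v"
  by (simp add: arc_center_def dist_norm field_simps)

lemma minor_arc_translate: "minor_arc \<rho> (a + v) (b + v) = (\<lambda>z. z + v) ` minor_arc \<rho> a b"
proof -
  have "z \<in> minor_arc \<rho> (a + v) (b + v) \<longleftrightarrow> z - v \<in> minor_arc \<rho> a b" for z
    by (simp add: minor_arc_def arc_center_translate left_side_def dist_norm algebra_simps)
  then show ?thesis
    by (force simp: image_iff)
qed

text \<open>The square root is the distance from the centre of a circle of radius \<rho> to a chord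
  of length 1, and the hypothesis says that such a chord fits into the circle. The last bound says
  that a minor arc on it has sagitta at most 1/2.\<close>

lemma sqrt_sagitta_bounds:
  fixes \<rho> :: real
  assumes "1/2 \<le> \<rho>"
  shows "0 \<le> sqrt (\<rho>\<^sup>2 - 1/4)" "(sqrt (\<rho>\<^sup>2 - 1/4))\<^sup>2 = \<rho>\<^sup>2 - 1/4"
    "sqrt (\<rho>\<^sup>2 - 1/4) \<le> \<rho>" "\<rho> \<le> sqrt (\<rho>\<^sup>2 - 1/4) + 1/2"
proof -
  have ge: "(1/2)\<^sup>2 \<le> \<rho>\<^sup>2"
    using assms by (intro power_mono) auto
  then show 1: "0 \<le> sqrt (\<rho>\<^sup>2 - 1/4)" and 2: "(sqrt (\<rho>\<^sup>2 - 1/4))\<^sup>2 = \<rho>\<^sup>2 - 1/4"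
    by (auto simp: power2_eq_square)
  show "sqrt (\<rho>\<^sup>2 - 1/4) \<le> \<rho>"
    using assms by (intro real_le_lsqrt) auto
  have "\<rho>\<^sup>2 \<le> (sqrt (\<rho>\<^sup>2 - 1/4) + 1/2)\<^sup>2"
    using 1 2 by (simp add: power2_eq_square algebra_simps)
  then show "\<rho> \<le> sqrt (\<rho>\<^sup>2 - 1/4) + 1/2"
    by (rule power2_le_imp_le) (use 1 in auto)
qed

lemma mem_sphere_complex: "0 \<le> \<rho> \<Longrightarrow> z \<in> sphere c \<rho> \<longleftrightarrow> (Re z - Re c)\<^sup>2 + (Im z - Im c)\<^sup>2 = \<rho>\<^sup>2"
  using power2_eq_iff_nonneg[of "norm (c - z)" \<rho>]
  by (simp add: dist_norm cmod_power2 power2_commute)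

lemma mem_cball_complex: "0 \<le> \<rho> \<Longrightarrow> z \<in> cball c \<rho> \<longleftrightarrow> (Re z - Re c)\<^sup>2 + (Im z - Im c)\<^sup>2 \<le> \<rho>\<^sup>2"
  using power_mono_iff[of "norm (c - z)" \<rho> 2]
  by (simp add: dist_norm cmod_power2 power2_commute)

lemma square_sides_cases:
  fixes \<rho> :: real
  assumes "(a, b) \<in> square_sides h"
  defines "\<delta> \<equiv> sqrt (\<rho>\<^sup>2 - 1/4)"
  obtains (left) "arc_center \<rho> a b = Complex (- \<delta>) (h + 1/2)" "left_side a b = {z. 0 \<le> Re z}"
  | (upper) "arc_center \<rho> a b = Complex (1/2) (1 + h + \<delta>)" "left_side a b = {z. Im z \<le> 1 + h}"
  | (right) "arc_center \<rho> a b = Complex (1 + \<delta>) (h + 1/2)" "left_side a b = {z. Re z \<le> 1}"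
proof -
  note simps = arc_center_unit_chord cmod_def left_side_def complex_eq_iff \<delta>_def
  consider "a = Complex 0 (1 + h)" "b = Complex 0 h"
    | "a = Complex 1 (1 + h)" "b = Complex 0 (1 + h)"
    | "a = Complex 1 h" "b = Complex 1 (1 + h)"
    using assms(1) by (auto simp: square_sides_def)
  then show thesis
  proof cases
    case 1
    then show thesis by (intro left) (auto simp: simps)
  next
    case 2
    then show thesis by (intro upper) (auto simp: simps)
  next
    case 3
    then show thesis by (intro right) (auto simp: simps)
  qed
qed

lemma dispersing_arc_subset_box:
  assumes \<rho>: "1/2 \<le> \<rho>" and ab: "(a, b) \<in> square_sides h"
  shows "minor_arc \<rho> a b \<subseteq> cbox (Complex 0 h) (Complex 1 (1 + h))"
proof
  fix z assume z: "z \<in> minor_arc \<rho> a b"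
  note s = sqrt_sagitta_bounds[OF \<rho>]
  define \<delta> where "\<delta> = sqrt (\<rho>\<^sup>2 - 1/4)"
  note s = s[folded \<delta>_def]
  \<comment> \<open>The three sides are treated together in coordinates adapted to the chord:
    \<open>x\<close> is the depth of the point beyond the chord, \<open>y\<close> its offset from
    the midpoint along the chord.\<close>
  have aux: "- 1/2 \<le> y \<and> y \<le> 1/2 \<and> x \<le> 1/2" if "0 \<le> x" "(x + \<delta>)\<^sup>2 + y\<^sup>2 = \<rho>\<^sup>2" for x y
  proof -
    have "\<delta>\<^sup>2 \<le> (x + \<delta>)\<^sup>2" using that s by (intro power_mono) auto
    then have "y\<^sup>2 \<le> (1/2)\<^sup>2" using that s by (simp add: power2_eq_square)
    then have "\<bar>y\<bar> \<le> 1/2" using abs_le_square_iff[of y "1/2"] by simp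
    moreover have "(x + \<delta>)\<^sup>2 \<le> \<rho>\<^sup>2"
      using that(2) zero_le_power2[of y] by linarith
    then have "x + \<delta> \<le> \<rho>"
      by (rule power2_le_imp_le) (use \<rho> in auto)
    ultimately show ?thesis using s by (intro conjI; linarith)
  qed
  from ab show "z \<in> cbox (Complex 0 h) (Complex 1 (1 + h))"
  proof (cases rule: square_sides_cases[where \<rho> = \<rho>])
    case left
    then have "0 \<le> Re z" "(Re z + \<delta>)\<^sup>2 + (Im z - (h + 1/2))\<^sup>2 = \<rho>\<^sup>2"
      using z \<rho> by (auto simp: minor_arc_def mem_sphere_complex \<delta>_def simp del: mem_sphere)
    from aux[OF this] this show ?thesis by (auto simp: in_cbox_complex_iff)
  next
    case right
    then have "0 \<le> 1 - Re z" "((1 - Re z) + \<delta>)\<^sup>2 + (Im z - (h + 1/2))\<^sup>2 = \<rho>\<^sup>2"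
      using z \<rho> by (auto simp: minor_arc_def mem_sphere_complex \<delta>_def power2_eq_square algebra_simps simp del: mem_sphere)
    from aux[OF this] this show ?thesis by (auto simp: in_cbox_complex_iff)
  next
    case upper
    then have "0 \<le> 1 + h - Im z" "((1 + h - Im z) + \<delta>)\<^sup>2 + (Re z - 1/2)\<^sup>2 = \<rho>\<^sup>2"
      using z \<rho> by (auto simp: minor_arc_def mem_sphere_complex \<delta>_def power2_eq_square algebra_simps simp del: mem_sphere)
    from aux[OF this] this show ?thesis by (auto simp: in_cbox_complex_iff)
  qed
qed

text \<open>For a side arc, the point is at horizontal distance at least \<open>\<delta>\<close> and
  vertical distance more than 1/2 from the centre, while
  \<open>\<delta>\<^sup>2 + 1/4 = \<rho>\<^sup>2\<close>. For the upper arc, the vertical distance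
  alone exceeds \<open>1 + \<delta>\<close>, which is more than \<rho>. It is applied to points of
  the focusing arc.\<close>

lemma dispersing_disc_below:
  assumes \<rho>: "1/2 \<le> \<rho>" and ab: "(a, b) \<in> square_sides h"
    and z: "0 \<le> Re z" "Re z \<le> 1" "Im z < h"
  shows "\<rho> < dist (arc_center \<rho> a b) z"
proof -
  define \<delta> where "\<delta> = sqrt (\<rho>\<^sup>2 - 1/4)"
  note s = sqrt_sagitta_bounds[OF \<rho>, folded \<delta>_def]
  have aux: "\<rho>\<^sup>2 < (x + \<delta>)\<^sup>2 + (Im z - (h + 1/2))\<^sup>2" if "0 \<le> x" for x
  proof -
    have "(1/2)\<^sup>2 < (h + 1/2 - Im z)\<^sup>2" using z by (intro power_strict_mono) auto
    moreover have "\<delta>\<^sup>2 \<le> (x + \<delta>)\<^sup>2" using that s by (intro power_mono) auto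
    ultimately show ?thesis using s by (simp add: power2_eq_square algebra_simps)
  qed
  have "z \<notin> cball (arc_center \<rho> a b) \<rho>"
    using ab
  proof (cases rule: square_sides_cases[where \<rho> = \<rho>])
    case left
    with aux[of "Re z"] z \<rho> show ?thesis
      by (simp add: mem_cball_complex \<delta>_def del: mem_cball)
  next
    case right
    with aux[of "1 - Re z"] z \<rho> show ?thesis
      by (simp add: mem_cball_complex \<delta>_def power2_eq_square algebra_simps del: mem_cball)
  next
    case upper
    have "\<rho>\<^sup>2 < (1 + h + \<delta> - Im z)\<^sup>2"
      using s z \<rho> by (intro power_strict_mono) auto
    then have "\<rho>\<^sup>2 < (Re z - 1/2)\<^sup>2 + (Im z - (1 + h + \<delta>))\<^sup>2"
      using zero_le_power2[of "Re z - 1/2"] unfolding power2_commute[of "Im z"] by linarith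
    with upper \<rho> show ?thesis
      by (simp add: mem_cball_complex \<delta>_def del: mem_cball)
  qed
  then show ?thesis by simp
qed

lemma focusing_center_eq:
  "focusing_center kf = Complex (1/2) (sqrt ((1 / kf)\<^sup>2 - 1/4))"
  by (simp add: focusing_center_def arc_center_unit_chord cmod_def complex_eq_iff)

lemma left_side_focusing: "left_side (Complex 1 0) (Complex 0 0) = {z. Im z \<le> 0}"
  by (auto simp: left_side_def)

text \<open>The centre lies at height \<open>\<delta>\<close> above the chord, so a point below the
  chord uses up at least \<open>\<delta>\<close> of the radius vertically and is left with at most
  1/2 horizontally. Its depth is at most the sagitta.\<close>

lemma focusing_segment_subset_box:
  assumes "0 < kf" "kf \<le> 1"
  shows "cball (focusing_center kf) (1 / kf) \<inter> left_side (Complex 1 0) (Complex 0 0)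
    \<subseteq> cbox (Complex 0 (- 1/2)) (Complex 1 0)"
proof
  fix z assume z: "z \<in> cball (focusing_center kf) (1 / kf) \<inter> left_side (Complex 1 0) (Complex 0 0)"
  have R: "1/2 \<le> 1 / kf" using assms by (simp add: field_simps)
  define \<delta> where "\<delta> = sqrt ((1 / kf)\<^sup>2 - 1/4)"
  note s = sqrt_sagitta_bounds[OF R, folded \<delta>_def]
  have y: "Im z \<le> 0" and d: "(Re z - 1/2)\<^sup>2 + (Im z - \<delta>)\<^sup>2 \<le> (1 / kf)\<^sup>2"
    using z assms unfolding left_side_focusing focusing_center_eq
    by (auto simp: mem_cball_complex \<delta>_def simp del: mem_cball)
  have "\<delta>\<^sup>2 \<le> (\<delta> - Im z)\<^sup>2" using y s by (intro power_mono) auto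
  then have "(Re z - 1/2)\<^sup>2 \<le> (1/2)\<^sup>2" using d s by (simp add: power2_eq_square algebra_simps)
  then have "\<bar>Re z - 1/2\<bar> \<le> 1/2" using abs_le_square_iff[of "Re z - 1/2" "1/2"] by simp
  then have "0 \<le> Re z" "Re z \<le> 1" by linarith+
  moreover have "\<delta> - Im z \<le> 1 / kf"
  proof (rule power2_le_imp_le)
    show "(\<delta> - Im z)\<^sup>2 \<le> (1 / kf)\<^sup>2"
      using d zero_le_power2[of "Re z - 1/2"] unfolding power2_commute[of \<delta>] by linarith
  qed (use assms in auto)
  ultimately show "z \<in> cbox (Complex 0 (- 1/2)) (Complex 1 0)"
    using s y by (auto simp: in_cbox_complex_iff)
qed

lemma focusing_arc_subset_box:
  assumes "0 < kf" "kf \<le> 1"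
  shows "focusing_arc kf \<subseteq> cbox (Complex 0 (- 1/2)) (Complex 1 0)"
  using focusing_segment_subset_box[OF assms] sphere_cball
  by (fastforce simp: focusing_arc_def minor_arc_def focusing_center_def)

lemma bulk_subset_box:
  assumes "0 < kf" "kf \<le> 1" "0 \<le> h"
  shows "bulk kd kf h \<subseteq> cbox (Complex 0 (- 1/2)) (Complex 1 (1 + h))"
  using focusing_segment_subset_box[OF assms(1,2)] assms(3)
  unfolding bulk_def by (fastforce simp: in_cbox_complex_iff)

section \<open>The optimal height\<close>

lemma mem_internally_tangent_disc_iff:
  fixes c s z :: "'a :: real_inner"
  assumes "0 \<le> \<beta>"
  shows "z \<in> cball (s + \<beta> *\<^sub>R (c - s)) (\<beta> * dist s c) \<longleftrightarrow>
    (z - s) \<bullet> (z - s) \<le> 2 * \<beta> * ((z - s) \<bullet> (c - s))"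
proof -
  have "z \<in> cball (s + \<beta> *\<^sub>R (c - s)) (\<beta> * dist s c) \<longleftrightarrow>
      norm ((z - s) - \<beta> *\<^sub>R (c - s)) \<le> norm (\<beta> *\<^sub>R (c - s))"
  proof -
    have "\<beta> * dist s c = norm (\<beta> *\<^sub>R (c - s))"
      using assms by (simp add: dist_norm norm_minus_commute)
    moreover have "dist (s + \<beta> *\<^sub>R (c - s)) z = norm ((z - s) - \<beta> *\<^sub>R (c - s))"
      by (simp add: dist_norm norm_minus_commute[of _ z] diff_diff_eq)
    ultimately show ?thesis by simp
  qed
  also have "\<dots> \<longleftrightarrow> (z - s) \<bullet> (z - s) \<le> 2 * \<beta> * ((z - s) \<bullet> (c - s))"
    unfolding norm_le by (simp add: inner_commute algebra_simps)
  finally show ?thesis .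
qed

text \<open>The negative curvature and the negative parameter reverse the normal twice, so the disc
  lies on the side of \<open>c\<close>, outside the table. It is the image of the disc bounded by
  the circle of the arc under the homothety with centre \<open>s\<close> and ratio 1/2.\<close>

lemma mem_tangent_disc_dispersing:
  assumes "kd < 0" "s \<in> sphere c (1 / \<bar>kd\<bar>)"
  shows "z \<in> tangent_disc (-2) kd c s \<longleftrightarrow> (z - s) \<bullet> (z - s) \<le> (z - s) \<bullet> (c - s)"
proof -
  have d: "norm (c - s) = 1 / \<bar>kd\<bar>" using assms by (simp add: dist_norm)
  have "tangent_disc (-2) kd c s = cball (s + (1/2) *\<^sub>R (c - s)) (1/2 * dist s c)"
    using assms by (simp add: tangent_disc_def sgn_div_norm dist_norm norm_minus_commute d)
  then show ?thesis
    using mem_internally_tangent_disc_iff[of "1/2" z s c] by simp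
qed

lemma mem_tangent_disc_focusing:
  assumes "0 < kf" "s \<in> sphere c (1 / kf)"
  shows "z \<in> tangent_disc 4 kf c s \<longleftrightarrow> (z - s) \<bullet> (z - s) \<le> (z - s) \<bullet> (c - s) / 2"
proof -
  have d: "norm (c - s) = 1 / kf" using assms by (simp add: dist_norm)
  have "tangent_disc 4 kf c s = cball (s + (1/4) *\<^sub>R (c - s)) (1/4 * dist s c)"
    using assms by (simp add: tangent_disc_def sgn_div_norm dist_norm norm_minus_commute d)
  then show ?thesis
    using mem_internally_tangent_disc_iff[of "1/4" z s c] by simp
qed

text \<open>The chord \<open>I(s', s'')\<close> runs from \<open>s'\<close> to the orthogonal projection of the centre \<open>c'\<close>
  to the line; \<open>\<mu>\<close> parametrizes it. In this form the condition is visibly closed in \<open>h\<close>.\<close>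
definition chord_condition ::
  "complex \<Rightarrow> complex \<Rightarrow> complex \<Rightarrow> complex \<Rightarrow> real \<Rightarrow> bool" where
  "chord_condition c' s' c'' s'' \<mu> \<longleftrightarrow>
     (let w = s' - s''; T = 1 + \<mu> * (w \<bullet> (c' - s')) / (w \<bullet> w)
      in T * T * (w \<bullet> w) \<le> T * (w \<bullet> (c'' - s'')) / 2)"

text \<open>On the line through the two points, each disc becomes a quadratic inequality in one real
  parameter. Rescaling the chord to \<open>{0..1}\<close> gives a parameter range that does not
  depend on the points, which is what the closedness argument needs.\<close>

lemma chord_inclusion_iff:
  assumes kd: "kd < 0" and kf: "0 < kf" and s': "s' \<in> sphere c' (1 / \<bar>kd\<bar>)"
    and s'': "s'' \<in> sphere c'' (1 / kf)" and ne: "s' \<noteq> s''"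
  shows "affine hull {s', s''} \<inter> tangent_disc (-2) kd c' s' \<subseteq> tangent_disc 4 kf c'' s''
    \<longleftrightarrow> (\<forall>\<mu>\<in>{0..1}. chord_condition c' s' c'' s'' \<mu>)"
proof -
  define w where "w = s' - s''"
  define W where "W = w \<bullet> w"
  define P where "P = w \<bullet> (c' - s')"
  define Q where "Q = w \<bullet> (c'' - s'')"
  have W: "0 < W" using ne by (simp add: W_def w_def)
  \<comment> \<open>Here \<open>t = 0\<close> is \<open>s'\<close> and \<open>t = -1\<close> is
    \<open>s''\<close>, so \<open>1 + t\<close> measures the position from
    \<open>s''\<close>.\<close>
  have hull: "affine hull {s', s''} = range (\<lambda>t. s' + t *\<^sub>R w)"
  proof -
    have "affine hull {s', s''} = {u *\<^sub>R s' + v *\<^sub>R s'' |u v. u + v = 1}"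
      by (rule affine_hull_2)
    also have "\<dots> = range (\<lambda>t. s' + t *\<^sub>R w)"
    proof (intro set_eqI iffI)
      fix x assume "x \<in> {u *\<^sub>R s' + v *\<^sub>R s'' |u v. u + v = 1}"
      then obtain u v where "x = u *\<^sub>R s' + v *\<^sub>R s''" "u + v = 1" by blast
      then have u: "u = 1 - v" and "x = u *\<^sub>R s' + v *\<^sub>R s''" by auto
      then have "x = s' + (- v) *\<^sub>R w"
        unfolding u by (simp add: w_def algebra_simps)
      then show "x \<in> range (\<lambda>t. s' + t *\<^sub>R w)" by blast
    next
      fix x assume "x \<in> range (\<lambda>t. s' + t *\<^sub>R w)"
      then obtain t where "x = s' + t *\<^sub>R w" by blast
      then have "x = (1 + t) *\<^sub>R s' + (- t) *\<^sub>R s''" by (simp add: w_def algebra_simps)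
      then show "x \<in> {u *\<^sub>R s' + v *\<^sub>R s'' |u v. u + v = 1}"
        by (intro CollectI exI[of _ "1 + t"] exI[of _ "- t"]) simp
    qed
    finally show ?thesis .
  qed
  have d2: "s' + t *\<^sub>R w \<in> tangent_disc (-2) kd c' s' \<longleftrightarrow> t * t * W \<le> t * P" for t
    by (simp add: mem_tangent_disc_dispersing[OF kd s'] W_def P_def mult.assoc)
  have d4: "s' + t *\<^sub>R w \<in> tangent_disc 4 kf c'' s'' \<longleftrightarrow> (1 + t) * (1 + t) * W \<le> (1 + t) * Q / 2" for t
  proof -
    have "s' + t *\<^sub>R w - s'' = (1 + t) *\<^sub>R w" by (simp add: w_def algebra_simps)
    then show ?thesis
      by (simp add: mem_tangent_disc_focusing[OF kf s''] W_def Q_def mult.assoc)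
  qed
  \<comment> \<open>The solutions form the segment between the roots 0 and \<open>P / W\<close>.
    Multiples of \<open>P / W\<close> describe it for either sign of \<open>P\<close>.\<close>
  have chord: "{t. t * t * W \<le> t * P} = (\<lambda>\<mu>. \<mu> * P / W) ` {0..1}"
  proof (intro set_eqI iffI)
    fix t assume "t \<in> {t. t * t * W \<le> t * P}"
    then have t: "t * t * W \<le> t * P" by simp
    show "t \<in> (\<lambda>\<mu>. \<mu> * P / W) ` {0..1}"
    proof (cases "t = 0")
      case True
      then show ?thesis by (intro image_eqI[of _ _ 0]) auto
    next
      case False
      then have "0 < t * t" by (metis not_real_square_gt_zero)
      then have "0 < t * t * W" using W by simp
      with t have tP: "0 < t * P" by linarith
      then have "P \<noteq> 0" by auto
      have "t * t * W / (t * P) \<le> 1" "0 \<le> t * t * W / (t * P)"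
        using t tP \<open>0 < t * t * W\<close> by (simp_all only: divide_le_eq_1_pos zero_le_divide_iff less_imp_le simp_thms)
      moreover have "t * t * W / (t * P) = t * W / P" using False by simp
      ultimately have "t * W / P \<in> {0..1}" by simp
      then show ?thesis
        by (rule image_eqI[rotated]) (use \<open>P \<noteq> 0\<close> W in simp)
    qed
  next
    fix t assume "t \<in> (\<lambda>\<mu>. \<mu> * P / W) ` {0..1}"
    then obtain \<mu> where l: "0 \<le> \<mu>" "\<mu> \<le> 1" "t = \<mu> * P / W" by auto
    have "t * t * W = \<mu> * \<mu> * (P * P / W)" unfolding l(3) using W by simp
    also have "\<dots> \<le> \<mu> * (P * P / W)"
      using l W by (intro mult_right_mono) (auto simp: mult_left_le)
    also have "\<dots> = t * P" using l by simp
    finally show "t \<in> {t. t * t * W \<le> t * P}" by simp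
  qed
  have "affine hull {s', s''} \<inter> tangent_disc (-2) kd c' s' \<subseteq> tangent_disc 4 kf c'' s''
      \<longleftrightarrow> (\<forall>t\<in>{t. t * t * W \<le> t * P}. (1 + t) * (1 + t) * W \<le> (1 + t) * Q / 2)"
    unfolding hull by (auto simp: d2 d4 image_iff subset_iff)
  also have "\<dots> \<longleftrightarrow> (\<forall>\<mu>\<in>{0..1}. chord_condition c' s' c'' s'' \<mu>)"
    unfolding chord by (simp add: chord_condition_def Let_def W_def P_def Q_def w_def)
  finally show ?thesis .
qed

section \<open>Attainment and order of magnitude of the optimal height\<close>

context
  fixes kd kf :: real
  assumes kd: "- 2 \<le> kd" "kd < 0" and kf: "0 < kf" "kf \<le> 1"
begin

lemma dispersing_radius: "1/2 \<le> 1 / \<bar>kd\<bar>"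
  using kd by (simp add: field_simps)

lemma focusing_arc_sphere: "s \<in> focusing_arc kf \<Longrightarrow> s \<in> sphere (focusing_center kf) (1 / kf)"
  by (simp add: focusing_arc_def focusing_center_def minor_arc_def)

text \<open>Since \<open>s'\<close> has height at least \<open>h > 0\<close> and \<open>s''\<close>
  height at most 0, the two points differ and the chord form applies. After translation, all
  quantifiers range over sets independent of \<open>h\<close>.\<close>

lemma focusing_condition_iff_chord:
  assumes h: "0 < h"
  shows "focusing_condition kd kf h \<longleftrightarrow>
    (\<forall>(a, b)\<in>square_sides 0. \<forall>s'\<in>minor_arc (1 / \<bar>kd\<bar>) a b. \<forall>s''\<in>focusing_arc kf. \<forall>\<mu>\<in>{0..1}.
      chord_condition (arc_center (1 / \<bar>kd\<bar>) a b + Complex 0 h) (s' + Complex 0 h)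
        (focusing_center kf) s'' \<mu>)"
proof -
  have "affine hull {s', s''} \<inter> tangent_disc (-2) kd (arc_center (1 / \<bar>kd\<bar>) a b) s'
          \<subseteq> tangent_disc 4 kf (focusing_center kf) s'' \<longleftrightarrow>
        (\<forall>\<mu>\<in>{0..1}. chord_condition (arc_center (1 / \<bar>kd\<bar>) a b) s' (focusing_center kf) s'' \<mu>)"
    if ab: "(a, b) \<in> square_sides h" and s': "s' \<in> minor_arc (1 / \<bar>kd\<bar>) a b"
      and s'': "s'' \<in> focusing_arc kf" for a b s' s''
  proof (rule chord_inclusion_iff)
    have "h \<le> Im s'"
      using dispersing_arc_subset_box[OF dispersing_radius ab] s'
      by (auto simp: in_cbox_complex_iff)
    moreover have "Im s'' \<le> 0"
      using focusing_arc_subset_box[OF kf] s'' by (auto simp: in_cbox_complex_iff)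
    ultimately show "s' \<noteq> s''" using h by auto
  qed (use s' s'' kd kf focusing_arc_sphere in \<open>auto simp: minor_arc_def\<close>)
  note key = this
  have "focusing_condition kd kf h \<longleftrightarrow>
    (\<forall>(a, b)\<in>square_sides h. \<forall>s'\<in>minor_arc (1 / \<bar>kd\<bar>) a b. \<forall>s''\<in>focusing_arc kf. \<forall>\<mu>\<in>{0..1}.
      chord_condition (arc_center (1 / \<bar>kd\<bar>) a b) s' (focusing_center kf) s'' \<mu>)"
    unfolding focusing_condition_def by (simp add: case_prod_unfold key cong: ball_cong)
  then show ?thesis
    unfolding square_sides_translate[of h]
    by (simp add: case_prod_unfold minor_arc_translate arc_center_translate)
qed

text \<open>An intersection, over a fixed index set, of solution sets of non-strict inequalities
  between functions continuous in \<open>h\<close>. The cut-off \<open>e\<close> keeps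
  \<open>s'\<close> away from \<open>s''\<close>, so the division in \<open>chord_condition\<close>
  is continuous.\<close>

lemma closed_focusing_condition:
  assumes e: "0 < e"
  shows "closed {h. e \<le> h \<and> focusing_condition kd kf h}"
proof -
  define X where "X = (SIGMA ab:square_sides 0. minor_arc (1 / \<bar>kd\<bar>) (fst ab) (snd ab) \<times> focusing_arc kf \<times> {0..1::real})"
  define F where "F = (\<lambda>((a, b), s', s'', \<mu>). {h. e \<le> h \<and>
    chord_condition (arc_center (1 / \<bar>kd\<bar>) a b + Complex 0 h) (s' + Complex 0 h) (focusing_center kf) s'' \<mu>})"
  have "square_sides 0 \<noteq> {}" by (simp add: square_sides_def)
  have "{h. e \<le> h \<and> focusing_condition kd kf h} = {e..} \<inter> (\<Inter>x\<in>X. F x)"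
    using e by (auto simp: focusing_condition_iff_chord X_def F_def)
      fastforce+
  moreover have "closed (F x)" if "x \<in> X" for x
  proof -
    obtain a b s' s'' \<mu> where x: "x = ((a, b), s', s'', \<mu>)" by (metis surj_pair)
    define w where "w = (\<lambda>h. s' + Complex 0 h - s'')"
    \<comment> \<open>Centre and arc move up together, so this difference does not depend on
      \<open>h\<close>.\<close>
    define c' where "c' = arc_center (1 / \<bar>kd\<bar>) a b - s'"
    define T where "T = (\<lambda>h. 1 + \<mu> * (w h \<bullet> c') / (w h \<bullet> w h))"
    have *: "(a, b) \<in> square_sides 0" "s' \<in> minor_arc (1 / \<bar>kd\<bar>) a b" "s'' \<in> focusing_arc kf"
      using that by (auto simp: x X_def)
    have "0 \<le> Im s'"
      using dispersing_arc_subset_box[OF dispersing_radius *(1)] *(2)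
      by (auto simp: in_cbox_complex_iff)
    moreover have "Im s'' \<le> 0"
      using focusing_arc_subset_box[OF kf] *(3) by (auto simp: in_cbox_complex_iff)
    ultimately have ne: "w h \<noteq> 0" if "h \<in> {e..}" for h
      using that e by (auto simp: w_def complex_eq_iff)
    have cw: "continuous_on {e..} w"
      unfolding w_def Complex_eq by (intro continuous_intros)
    have cT: "continuous_on {e..} T"
      unfolding T_def using ne by (intro continuous_intros cw) auto
    have "F x = {h\<in>{e..}. T h * T h * (w h \<bullet> w h) \<le> T h * (w h \<bullet> (focusing_center kf - s'')) / 2}"
      by (auto simp: F_def x chord_condition_def Let_def T_def w_def c'_def)
    moreover have "closed \<dots>"
      by (intro continuous_on_closed_Collect_le continuous_intros cw cT closed_atLeast) auto
    ultimately show ?thesis by simp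
  qed
  ultimately show ?thesis
    by (simp only:) (intro closed_Int closed_atLeast closed_INT, blast)
qed

text \<open>It suffices to test one pair: the lower left corner of the square against the opposite
  end (1,0) of the focusing arc, with \<mu> = 0, that is, with the point \<open>s'\<close> itself.
  This gives \<open>h * \<delta> \<ge> 1\<close>, where
  \<open>\<delta> \<le> 1 / kf\<close>.\<close>

lemma focusing_condition_lower_bound:
  assumes h: "0 < h" and fc: "focusing_condition kd kf h"
  shows "kf \<le> h"
proof -
  define \<rho> where "\<rho> = 1 / \<bar>kd\<bar>"
  define \<delta> where "\<delta> = sqrt ((1 / kf)\<^sup>2 - 1/4)"
  have R: "1/2 \<le> 1 / kf" using kf by (simp add: field_simps)
  note s = sqrt_sagitta_bounds[OF R, folded \<delta>_def]
  note s2 = sqrt_sagitta_bounds[OF dispersing_radius]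
  let ?a = "Complex 0 1" and ?b = "Complex 0 0"
  have ab: "(?a, ?b) \<in> square_sides 0" by (simp add: square_sides_def)
  have c: "arc_center \<rho> ?a ?b = Complex (- sqrt (\<rho>\<^sup>2 - 1/4)) (1/2)"
    by (simp add: arc_center_unit_chord cmod_def complex_eq_iff)
  have s': "Complex 0 0 \<in> minor_arc (1 / \<bar>kd\<bar>) ?a ?b"
    unfolding minor_arc_def c[unfolded \<rho>_def] using s2 dispersing_radius
    by (simp add: left_side_def mem_sphere_complex del: mem_sphere) (simp add: power2_eq_square)
  have s'': "Complex 1 0 \<in> focusing_arc kf"
    unfolding focusing_arc_def minor_arc_def left_side_focusing focusing_center_def[symmetric]
      focusing_center_eq
    using s(2) R kf by (simp add: mem_sphere_complex \<delta>_def del: mem_sphere) (simp add: power2_eq_square)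
  have "chord_condition (arc_center (1 / \<bar>kd\<bar>) ?a ?b + Complex 0 h) (Complex 0 0 + Complex 0 h)
        (focusing_center kf) (Complex 1 0) 0"
    using fc[unfolded focusing_condition_iff_chord[OF h]] ab s' s''
    by (metis (no_types, lifting) atLeastAtMost_iff case_prodD order_refl zero_le_one)
  then have "1 + h * h \<le> (1/2 + h * \<delta>) / 2"
    by (simp add: chord_condition_def focusing_center_eq inner_complex_def \<delta>_def)
  moreover have "0 \<le> h * h" by simp
  ultimately have "1 \<le> h * \<delta>" by argo
  also have "\<dots> \<le> h * (1 / kf)" using s h by (intro mult_left_mono) auto
  finally show ?thesis using kf by (simp add: field_simps)
qed

text \<open>After cancelling a factor \<open>T \<ge> 0\<close>, the chord condition reads
  \<open>W + \<mu> * P \<le> Q / 2\<close>. The left side is bounded in terms of the dispersing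
  radius, whereas \<open>Q\<close> contains the product of a height at least \<open>h\<close> with
  the height of the focusing centre, of order \<open>1 / kf\<close>.\<close>

lemma focusing_condition_holds:
  defines "h \<equiv> (65 + 16 / \<bar>kd\<bar>) * kf"
  assumes h1: "h \<le> 1"
  shows "focusing_condition kd kf h"
proof -
  have h: "0 < h" using kf by (simp add: h_def add_pos_nonneg)
  define \<rho> where "\<rho> = 1 / \<bar>kd\<bar>"
  define \<delta> where "\<delta> = sqrt ((1 / kf)\<^sup>2 - 1/4)"
  have \<rho>: "1/2 \<le> \<rho>" using dispersing_radius by (simp add: \<rho>_def)
  have R: "1/2 \<le> 1 / kf" using kf by (simp add: field_simps)
  have "1 \<le> 1 / kf" using kf by simp
  then have \<delta>: "1 / (2 * kf) \<le> \<delta>"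
    using sqrt_sagitta_bounds(4)[OF R, folded \<delta>_def] by simp
  have main: "chord_condition c' s' (focusing_center kf) s'' \<mu>"
    if ab: "(a, b) \<in> square_sides h" and c': "c' = arc_center \<rho> a b" and s': "s' \<in> minor_arc \<rho> a b"
      and s'': "s'' \<in> focusing_arc kf" and \<mu>: "0 \<le> \<mu>" "\<mu> \<le> 1" for a b c' s' s'' \<mu>
  proof -
    define w where "w = s' - s''"
    define W where "W = w \<bullet> w"
    define P where "P = w \<bullet> (c' - s')"
    define Q where "Q = w \<bullet> (focusing_center kf - s'')"
    have b': "0 \<le> Re s'" "Re s' \<le> 1" "h \<le> Im s'" "Im s' \<le> 1 + h"
      using dispersing_arc_subset_box[OF \<rho> ab] s' by (auto simp: in_cbox_complex_iff)
    have b'': "0 \<le> Re s''" "Re s'' \<le> 1" "Im s'' \<le> 0" "- 1/2 \<le> Im s''"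
      using focusing_arc_subset_box[OF kf] s'' by (auto simp: in_cbox_complex_iff)
    have "norm w \<le> \<bar>Re w\<bar> + \<bar>Im w\<bar>" by (rule cmod_le)
    also have "\<dots> \<le> 4" using b' b'' h1 h unfolding w_def minus_complex.sel by linarith
    finally have w4: "norm w \<le> 4" .
    have W0: "0 < W" using b' b'' h by (auto simp: W_def w_def complex_eq_iff)
    have W16: "W \<le> 16"
      using power_mono[OF w4, of 2] by (simp add: W_def power2_norm_eq_inner)
    have ds': "norm (c' - s') = \<rho>" using s' by (simp add: c' minor_arc_def dist_norm)
    have "P \<le> norm w * norm (c' - s')" unfolding P_def by (rule norm_cauchy_schwarz)
    also have "\<dots> \<le> 4 * \<rho>" using w4 \<rho> ds' by (auto intro: mult_right_mono)
    finally have P4: "P \<le> 4 * \<rho>" .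
    \<comment> \<open>The point \<open>s''\<close> is outside the dispersing circle through
      \<open>s'\<close>. Comparing its distance to \<open>c'\<close> with that of \<open>s'\<close>
      yields \<open>W + 2 * P \<ge> 0\<close>, hence \<open>T \<ge> 0\<close>: the chord does not
      extend beyond \<open>s''\<close>.\<close>
    have "\<rho> < dist c' s''" unfolding c' using \<rho> ab b'' h by (intro dispersing_disc_below) auto
    then have "(norm (c' - s'))\<^sup>2 < (norm (c' - s' + w))\<^sup>2"
      using ds' \<rho> by (intro power_strict_mono) (auto simp: dist_norm w_def)
    then have WP: "0 \<le> W + 2 * P"
      unfolding power2_norm_eq_inner by (simp add: W_def P_def inner_add inner_commute)
    then have "0 \<le> W + P" using W0 by linarith
    have T0: "0 \<le> W + \<mu> * P"
    proof (cases "0 \<le> P")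
      case False
      then have "1 * P \<le> \<mu> * P" using \<mu> by (intro mult_right_mono_neg) auto
      then show ?thesis using \<open>0 \<le> W + P\<close> by simp
    qed (use W0 \<mu> in simp)
    have "\<mu> * P \<le> \<mu> * (4 * \<rho>)" using \<mu> P4 by (intro mult_left_mono) auto
    also have "\<dots> \<le> 1 * (4 * \<rho>)" using \<mu> \<rho> by (intro mult_right_mono) auto
    finally have T1: "W + \<mu> * P \<le> 16 + 4 * \<rho>" using W16 by simp
    \<comment> \<open>The constant is chosen so that \<open>h / (2 * kf)\<close> equals
      \<open>2 * (16 + 4 * \<rho>) + 1/2\<close>: twice the bound on \<open>W + \<mu> * P\<close>,
      plus the largest possible loss from the horizontal product.\<close>
    have "65 + 16 * \<rho> = h / kf" using kf by (simp add: h_def \<rho>_def)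
    then have "32 + 8 * \<rho> \<le> - 1/2 + h * (1 / (2 * kf))" using \<rho> by simp
    also have "\<dots> \<le> (Re s' - Re s'') * (1/2 - Re s'') + (Im s' - Im s'') * (\<delta> - Im s'')"
    proof (rule add_mono)
      have "\<bar>(Re s' - Re s'') * (1/2 - Re s'')\<bar> \<le> 1 * (1/2)"
        unfolding abs_mult using b' b'' by (intro mult_mono) (auto simp: abs_if)
      then show "- 1/2 \<le> (Re s' - Re s'') * (1/2 - Re s'')" by linarith
      show "h * (1 / (2 * kf)) \<le> (Im s' - Im s'') * (\<delta> - Im s'')"
        using b' b'' \<delta> h kf by (intro mult_mono) auto
    qed
    also have "\<dots> = Q"
      by (simp add: Q_def w_def focusing_center_eq inner_complex_def \<delta>_def)
    finally have Q: "W + \<mu> * P \<le> Q / 2" using T1 by simp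
    define T where "T = 1 + \<mu> * P / W"
    have TW: "T * W = W + \<mu> * P" using W0 by (simp add: T_def field_simps)
    then have "0 \<le> T" using T0 W0 by (metis zero_le_mult_iff not_less)
    then have "T * (T * W) \<le> T * (Q / 2)" using Q TW by (intro mult_left_mono) auto
    then show ?thesis
      by (simp add: chord_condition_def Let_def T_def W_def P_def Q_def w_def mult.assoc)
  qed
  show ?thesis
    unfolding focusing_condition_iff_chord[OF h]
  proof clarify
    fix a b s' s'' and \<mu> :: real
    assume "(a, b) \<in> square_sides 0" "s' \<in> minor_arc (1 / \<bar>kd\<bar>) a b" "s'' \<in> focusing_arc kf" "\<mu> \<in> {0..1}"
    then show "chord_condition (arc_center (1 / \<bar>kd\<bar>) a b + Complex 0 h) (s' + Complex 0 h)
        (focusing_center kf) s'' \<mu>"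
      using square_sides_translate[of h]
      by (intro main[of "a + Complex 0 h" "b + Complex 0 h"])
        (auto simp: \<rho>_def arc_center_translate minor_arc_translate)
  qed
qed

text \<open>The lower bound replaces the open constraint \<open>0 < h\<close> by the closed one
  \<open>kf \<le> h\<close>. The admissible set is then closed, nonempty and bounded below, so its
  infimum belongs to it and is the value of \<open>LEAST\<close>.\<close>

lemma h_opt_bounds:
  assumes "(65 + 16 / \<bar>kd\<bar>) * kf \<le> 1"
  shows "0 < h_opt kd kf" "h_opt kd kf \<le> (65 + 16 / \<bar>kd\<bar>) * kf"
proof -
  define S where "S = {h. kf \<le> h \<and> focusing_condition kd kf h}"
  have S: "h \<in> S \<longleftrightarrow> 0 < h \<and> focusing_condition kd kf h" for h
    using focusing_condition_lower_bound kf by (auto simp: S_def)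
  have h: "(65 + 16 / \<bar>kd\<bar>) * kf \<in> S"
    using focusing_condition_holds[OF assms] kf by (simp add: S add_pos_nonneg)
  have bdd: "bdd_below S" by (auto simp: S_def intro: bdd_belowI)
  have "Inf S \<in> S"
    using h bdd closed_focusing_condition[OF kf(1)] by (intro closed_contains_Inf) (auto simp: S_def)
  moreover have "h_opt kd kf = Inf S"
    unfolding h_opt_def S[symmetric] using \<open>Inf S \<in> S\<close> bdd
    by (intro Least_equality) (auto intro: cInf_lower)
  ultimately show "0 < h_opt kd kf" "h_opt kd kf \<le> (65 + 16 / \<bar>kd\<bar>) * kf"
    using cInf_lower[OF h bdd] by (auto simp: S)
qed

end

section \<open>The spirals\<close>

lemma norm_heading [simp]: "norm (heading \<gamma> \<epsilon> i) = 1"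
  by (cases \<epsilon>) (auto simp: heading_def norm_mult)

lemma interior_triangle_nonempty:
  fixes a b c :: complex
  assumes "(b - a) / (c - a) \<notin> \<real>"
  shows "interior (convex hull {a, b, c}) \<noteq> {}"
proof -
  have "\<not> collinear {c, a, b}"
    using assms by (simp add: collinear_3 collinear_iff_Reals)
  then have "\<not> affine_dependent {a, b, c}" "a \<noteq> b" "a \<noteq> c" "b \<noteq> c"
    by (auto simp: collinear_3_eq_affine_dependent insert_commute)
  then show ?thesis
    by (subst interior_convex_hull_eq_empty) auto
qed

text \<open>The wrapping condition speaks of interiors only; this recovers the whole trapezoid from
  its interior. The triangle at the near vertex is nondegenerate because its edges, the shorter base
  and the perpendicular leg, have a purely imaginary nonzero ratio.\<close>

lemma closure_interior_trapezoid:
  assumes "0 < l \<epsilon> i" "0 < leg_length h \<gamma> \<epsilon> i"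
  shows "trapezoid h \<gamma> l \<epsilon> i \<subseteq> closure (interior (trapezoid h \<gamma> l \<epsilon> i))"
proof -
  define e p q where "e = heading \<gamma> \<epsilon> i" and "p = near_vertex h \<gamma> l \<epsilon> i" and "q = far_vertex h \<gamma> l \<epsilon> i"
  have "norm e = 1" by (simp add: e_def)
  then have "e \<noteq> 0" by auto
  then have "(p + l \<epsilon> i *\<^sub>R e - p) / (q - p) = \<i> * of_real (l \<epsilon> i / leg_length h \<gamma> \<epsilon> i)"
    using assms by (simp add: q_def far_vertex_def e_def p_def scaleR_conv_of_real field_simps)
  also have "\<dots> \<notin> \<real>"
    using assms by (simp add: complex_is_Real_iff)
  finally have "interior (convex hull {p, p + l \<epsilon> i *\<^sub>R e, q}) \<noteq> {}"
    by (rule interior_triangle_nonempty)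
  moreover have "convex hull {p, p + l \<epsilon> i *\<^sub>R e, q} \<subseteq> trapezoid h \<gamma> l \<epsilon> i"
    unfolding trapezoid_def e_def p_def q_def by (rule hull_mono) auto
  ultimately have "interior (trapezoid h \<gamma> l \<epsilon> i) \<noteq> {}"
    using interior_mono by blast
  then have "closure (interior (trapezoid h \<gamma> l \<epsilon> i)) = closure (trapezoid h \<gamma> l \<epsilon> i)"
    by (intro convex_closure_interior) (auto simp: trapezoid_def)
  then show ?thesis using closure_subset by auto
qed

lemma similar_iterates_subset_cball:
  fixes A u :: complex
  assumes step: "\<forall>i\<in>{m..<L}. P (Suc i) = (\<lambda>z. A + c *\<^sub>R (u * (z - A))) ` P i"
    and "norm u = 1" "0 \<le> c" "P m \<subseteq> cball A R" and "m \<le> i" "i \<le> L"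
  shows "P i \<subseteq> cball A (c ^ (i - m) * R)"
  using \<open>m \<le> i\<close> \<open>i \<le> L\<close>
proof (induction i rule: dec_induct)
  case base
  then show ?case using assms by simp
next
  case (step i)
  then have IH: "P i \<subseteq> cball A (c ^ (i - m) * R)" by simp
  show ?case
  proof
    fix y assume "y \<in> P (Suc i)"
    then obtain z where z: "z \<in> P i" "y = A + c *\<^sub>R (u * (z - A))"
      using assms(1) step by auto
    have "dist A y = c * norm (z - A)"
      using z assms by (simp add: dist_norm norm_mult)
    also have "\<dots> \<le> c * (c ^ (i - m) * R)"
      using IH z assms by (intro mult_left_mono) (auto simp: dist_norm norm_minus_commute)
    finally show "y \<in> cball A (c ^ (Suc i - m) * R)"
      using step by (simp add: Suc_diff_le mult.assoc)
  qed
qed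

section \<open>Growth of the regular double spiral\<close>

context
  fixes r0 :: real and m :: "side \<Rightarrow> nat" and \<gamma> :: "side \<Rightarrow> nat \<Rightarrow> real" and N :: nat
  assumes r0: "0 < r0"
    and angle: "\<And>\<epsilon> i. 1 \<le> i \<Longrightarrow> i < m \<epsilon> \<Longrightarrow> 0 < \<gamma> \<epsilon> i \<and> \<gamma> \<epsilon> i < pi / 2"
    and \<theta>: "0 < 2 * pi / real N" "2 * pi / real N < pi / 2"
begin

lemma cos_angle_pos: "1 \<le> i \<Longrightarrow> i < m \<epsilon> \<Longrightarrow> 0 < cos (\<gamma> \<epsilon> i)"
  using angle[of i \<epsilon>] by (intro cos_gt_zero) auto

lemma K4_pos: "0 < K4 m \<gamma>"
  unfolding K4_def by (intro add_pos_pos prod_pos) (auto simp: cos_angle_pos)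

lemma growth_rate_ge_1: "1 \<le> 1 / cos (2 * pi / real N)"
  using cos_gt_zero[OF \<theta>] by simp

text \<open>This is the tight wrapping relation solved for the growth factor: in one round the inner
  radius \<open>r0\<close> increases by the full width \<open>K4 m \<gamma> * h\<close>. It makes
  the growth depend on \<open>h\<close> alone, without any estimate of \<open>N\<close>.\<close>

lemma growth_per_round:
  "(1 / cos (2 * pi / real N)) ^ N = 1 + K4 m \<gamma> * opening_length r0 m \<gamma> N / r0"
  using K4_pos r0 by (simp add: opening_length_def)

lemma opening_length_nonneg: "0 \<le> opening_length r0 m \<gamma> N"
  using K4_pos r0 one_le_power[OF growth_rate_ge_1, of N]
  by (simp add: opening_length_def)

lemma leg_length_nonneg: "0 \<le> leg_length (opening_length r0 m \<gamma> N) (full_angles m \<gamma> N) \<epsilon> i"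
  unfolding leg_length_def
  by (intro mult_nonneg_nonneg opening_length_nonneg prod_nonneg)
    (auto simp: full_angles_def intro!: less_imp_le[OF cos_angle_pos] less_imp_le[OF cos_gt_zero[OF \<theta>]])

lemma leg_length_initial_pos:
  assumes "0 < opening_length r0 m \<gamma> N" "i \<le> m \<epsilon>"
  shows "0 < leg_length (opening_length r0 m \<gamma> N) (full_angles m \<gamma> N) \<epsilon> i"
  unfolding leg_length_def using assms
  by (intro mult_pos_pos prod_pos) (auto simp: full_angles_def intro: cos_angle_pos)

lemma first_regular_legs:
  "leg_length h (full_angles m \<gamma> N) Rgt (m Rgt) + leg_length h (full_angles m \<gamma> N) Lft (m Lft) = K4 m \<gamma> * h"
  by (simp add: leg_length_def K4_def full_angles_def algebra_simps)

text \<open>Both perpendicular legs lie on the initial ray within \<open>2 * r0\<close> of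
  \<open>A\<close>, because their total length is at most \<open>r0\<close>. The bases start there
  and have length at most \<open>6 * r0\<close>.\<close>

lemma first_regular_trapezoid_bound:
  assumes spiral: "regular_double_spiral kf A r0 m \<gamma> N l"
    and small: "K4 m \<gamma> * opening_length r0 m \<gamma> N \<le> r0"
  shows "spiral_piece r0 m \<gamma> N l \<epsilon> (m \<epsilon>) \<subseteq> cball A (8 * r0)"
proof -
  define h g where "h = opening_length r0 m \<gamma> N" and "g = full_angles m \<gamma> N"
  define \<theta>' where "\<theta>' = 2 * pi / real N"
  define H where "H = (\<lambda>\<epsilon>. leg_length h g \<epsilon> (m \<epsilon>))"
  have H0: "0 \<le> H \<epsilon>" for \<epsilon> using leg_length_nonneg by (simp add: H_def h_def g_def)
  have H1: "H Rgt + H Lft \<le> r0" using first_regular_legs small by (simp add: H_def h_def g_def)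
  \<comment> \<open>For \<open>N = 0\<close>, division by zero would make the turning angle
    0.\<close>
  have "N \<noteq> 0" using \<theta> by (cases "N = 0") auto
  \<comment> \<open>A single turn enlarges by no more than a full round, whose factor is at most 2
    for a thin spiral. This controls the tangent.\<close>
  have "1 / cos \<theta>' \<le> (1 / cos \<theta>') ^ N"
    using growth_rate_ge_1 \<open>N \<noteq> 0\<close> by (intro self_le_power) (auto simp: \<theta>'_def)
  also have "\<dots> \<le> 2"
    using small r0 unfolding \<theta>'_def growth_per_round by simp
  finally have c2: "1 / cos \<theta>' \<le> 2" .
  have cpos: "0 < cos \<theta>'" unfolding \<theta>'_def using \<theta> by (intro cos_gt_zero)
  have "tan \<theta>' = sin \<theta>' * (1 / cos \<theta>')" by (simp add: tan_def)
  also have "\<dots> \<le> 1 * (1 / cos \<theta>')" using cpos by (intro mult_right_mono) auto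
  finally have t2: "tan \<theta>' \<le> 2" using c2 by simp
  have t0: "0 \<le> tan \<theta>'" unfolding \<theta>'_def using \<theta> by (intro less_imp_le tan_gt_zero)
  obtain v where v: "norm v = 1"
    "near_vertex h g l Rgt (m Rgt) = A + r0 *\<^sub>R v"
    "far_vertex h g l Rgt (m Rgt) = A + (r0 + H Rgt) *\<^sub>R v"
    "near_vertex h g l Lft (m Lft) = A + (r0 + H Rgt) *\<^sub>R v"
    "far_vertex h g l Lft (m Lft) = A + (r0 + H Rgt + H Lft) *\<^sub>R v"
    "l Rgt (m Rgt) = r0 * tan \<theta>'" "l Lft (m Lft) = (r0 + H Rgt) * tan \<theta>'"
    using spiral unfolding regular_double_spiral_def Let_def H_def h_def g_def \<theta>'_def by blast
  have mult_tan: "0 \<le> x * tan \<theta>' \<and> x * tan \<theta>' \<le> x * 2" if "0 \<le> x" for x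
    using that t0 t2 by (simp add: mult_left_mono)
  have l: "0 \<le> l \<epsilon> (m \<epsilon>) \<and> l \<epsilon> (m \<epsilon>) \<le> 4 * r0"
  proof (cases \<epsilon>)
    case Rgt
    then show ?thesis using mult_tan[of r0] r0 by (simp add: v)
  next
    case Lft
    have "0 \<le> r0 + H Rgt" using r0 H0[of Rgt] by simp
    moreover have "(r0 + H Rgt) * 2 \<le> 4 * r0" using H0[of Lft] H1 by simp
    ultimately show ?thesis
      unfolding Lft v using mult_tan order_trans by blast
  qed
  have near: "norm (near_vertex h g l \<epsilon> (m \<epsilon>) - A) \<le> 2 * r0"
    using r0 H0[of Rgt] H0[of Lft] H1 by (cases \<epsilon>) (auto simp: v)
  have far: "norm (far_vertex h g l \<epsilon> (m \<epsilon>) - A) \<le> 2 * r0"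
    using r0 H0[of Rgt] H0[of Lft] H1 by (cases \<epsilon>) (auto simp: v)
  have "H \<epsilon> \<le> r0" using H0[of Rgt] H0[of Lft] H1 by (cases \<epsilon>) auto
  then have Ht: "0 \<le> H \<epsilon> * tan \<theta>' \<and> H \<epsilon> * tan \<theta>' \<le> 2 * r0"
    using mult_tan[OF H0[of \<epsilon>]] by auto
  \<comment> \<open>The 6 is 4 for the shorter base plus 2 for the extra length of the longer
    base.\<close>
  have shift: "norm (p + t *\<^sub>R heading g \<epsilon> (m \<epsilon>) - A) \<le> 8 * r0"
    if "norm (p - A) \<le> 2 * r0" "0 \<le> t" "t \<le> 6 * r0" for p t
    using norm_triangle_ineq[of "p - A" "t *\<^sub>R heading g \<epsilon> (m \<epsilon>)"] that
    by (simp add: algebra_simps)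
  have "g \<epsilon> (m \<epsilon>) = \<theta>'" by (simp add: g_def full_angles_def \<theta>'_def)
  then have "{near_vertex h g l \<epsilon> (m \<epsilon>),
        near_vertex h g l \<epsilon> (m \<epsilon>) + l \<epsilon> (m \<epsilon>) *\<^sub>R heading g \<epsilon> (m \<epsilon>),
        far_vertex h g l \<epsilon> (m \<epsilon>)
          + (l \<epsilon> (m \<epsilon>) + leg_length h g \<epsilon> (m \<epsilon>) * tan (g \<epsilon> (m \<epsilon>))) *\<^sub>R heading g \<epsilon> (m \<epsilon>),
        far_vertex h g l \<epsilon> (m \<epsilon>)} \<subseteq> cball A (8 * r0)"
    using near far l Ht r0 shift[OF near, of "l \<epsilon> (m \<epsilon>)"]
      shift[OF far, of "l \<epsilon> (m \<epsilon>) + H \<epsilon> * tan \<theta>'"]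
    by (simp add: dist_norm norm_minus_commute[of A] H_def)
  then show ?thesis
    unfolding spiral_piece_def trapezoid_def h_def g_def by (intro hull_minimal convex_cball)
qed

text \<open>At most \<open>rounds r0 kf * N\<close> similarities are applied to the first regular
  trapezoid. Grouping them into rounds gives a power of \<open>1 + x\<close>, which is bounded by an
  exponential.\<close>

lemma regular_trapezoid_bound:
  assumes spiral: "regular_double_spiral kf A r0 m \<gamma> N l"
    and small: "K4 m \<gamma> * opening_length r0 m \<gamma> N \<le> r0"
    and i: "i \<in> {m \<epsilon>..last_index kf r0 m N \<epsilon>}"
  shows "spiral_piece r0 m \<gamma> N l \<epsilon> i
    \<subseteq> cball A (8 * r0 * exp (real (rounds r0 kf) * (K4 m \<gamma> * opening_length r0 m \<gamma> N / r0)))"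
proof -
  define c where "c = 1 / cos (2 * pi / real N)"
  define x where "x = K4 m \<gamma> * opening_length r0 m \<gamma> N / r0"
  have c1: "1 \<le> c" using growth_rate_ge_1 by (simp add: c_def)
  have x0: "0 \<le> x" using K4_pos r0 opening_length_nonneg by (simp add: x_def)
  have "spiral_piece r0 m \<gamma> N l \<epsilon> i \<subseteq> cball A (c ^ (i - m \<epsilon>) * (8 * r0))"
  proof (rule similar_iterates_subset_cball)
    show "\<forall>i\<in>{m \<epsilon>..<last_index kf r0 m N \<epsilon>}. spiral_piece r0 m \<gamma> N l \<epsilon> (Suc i) =
        (\<lambda>z. A + c *\<^sub>R (cis (2 * pi / real N) * (z - A))) ` spiral_piece r0 m \<gamma> N l \<epsilon> i"
      using spiral unfolding regular_double_spiral_def Let_def c_def by blast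
  qed (use c1 i first_regular_trapezoid_bound[OF spiral small] in auto)
  also have "\<dots> \<subseteq> cball A (8 * r0 * exp (real (rounds r0 kf) * x))"
  proof (rule subset_cball)
    have "c ^ (i - m \<epsilon>) \<le> c ^ (N * rounds r0 kf)"
      using i c1 by (intro power_increasing) (auto simp: last_index_def mult.commute)
    also have "\<dots> = (1 + x) ^ rounds r0 kf"
      by (simp only: power_mult c_def growth_per_round x_def)
    also have "\<dots> \<le> exp x ^ rounds r0 kf"
      using x0 by (intro power_mono exp_ge_add_one_self) auto
    also have "\<dots> = exp (real (rounds r0 kf) * x)" by (simp add: exp_of_nat_mult)
    finally show "c ^ (i - m \<epsilon>) * (8 * r0) \<le> 8 * r0 * exp (real (rounds r0 kf) * x)"
      using r0 by (simp add: mult.commute)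
  qed
  finally show ?thesis by (simp add: x_def)
qed

text \<open>The bases of the initial trapezoids are not controlled individually, so these trapezoids are
  bounded through the part of the spiral that surrounds them.\<close>
lemma spirals_bound:
  assumes table: "double_spiral_table kd kf A r0 m \<gamma> N l"
    and pos: "0 < opening_length r0 m \<gamma> N"
    and small: "K4 m \<gamma> * opening_length r0 m \<gamma> N \<le> r0"
    and i: "i \<in> {1..last_index kf r0 m N \<epsilon>}"
  shows "spiral_piece r0 m \<gamma> N l \<epsilon> i
    \<subseteq> cball A (8 * r0 * exp (real (rounds r0 kf) * (K4 m \<gamma> * opening_length r0 m \<gamma> N / r0)))"
    (is "_ \<subseteq> ?B")
proof -
  have spiral: "regular_double_spiral kf A r0 m \<gamma> N l"
    and wraps: "wraps_around kd kf r0 m \<gamma> N l" and l: "0 < l \<epsilon> i"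
    using table i by (auto simp: double_spiral_table_def)
  note reg = regular_trapezoid_bound[OF spiral small]
  show ?thesis
  proof (cases "m \<epsilon> \<le> i")
    case True
    then show ?thesis using i by (intro reg) auto
  next
    case False
    have "regular_part kf r0 m \<gamma> N l \<subseteq> ?B"
      unfolding regular_part_def by (intro UN_least reg)
    \<comment> \<open>Every point off a convex superset is in the outside of the set, so the inside
      cannot leave the ball.\<close>
    then have "inside (regular_part kf r0 m \<gamma> N l) \<subseteq> ?B"
      using outside_subset_convex[OF convex_cball, of "regular_part kf r0 m \<gamma> N l"]
        inside_Int_outside by blast
    moreover have "interior (spiral_piece r0 m \<gamma> N l \<epsilon> i) \<subseteq> inside (regular_part kf r0 m \<gamma> N l)"
      using wraps False i unfolding wraps_around_def by force
    ultimately have "closure (interior (spiral_piece r0 m \<gamma> N l \<epsilon> i)) \<subseteq> ?B"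
      by (intro closure_minimal) auto
    moreover have "spiral_piece r0 m \<gamma> N l \<epsilon> i \<subseteq> closure (interior (spiral_piece r0 m \<gamma> N l \<epsilon> i))"
      unfolding spiral_piece_def using False l pos
      by (intro closure_interior_trapezoid leg_length_initial_pos) auto
    ultimately show ?thesis by blast
  qed
qed

end

section \<open>Bounds uniform in the focusing curvature\<close>

lemma rounds_mult_le:
  assumes "0 < r0" "0 < kf"
  shows "real (rounds r0 kf) * kf \<le> 1 / (2 * pi * r0) + kf"
proof -
  have "0 \<le> 1 / (2 * pi * r0 * kf)" using assms by simp
  then have "real (rounds r0 kf) \<le> 1 / (2 * pi * r0 * kf) + 1"
    by (simp add: rounds_def)
  then have "real (rounds r0 kf) * kf \<le> (1 / (2 * pi * r0 * kf) + 1) * kf"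
    using assms by (intro mult_right_mono) auto
  also have "\<dots> = 1 / (2 * pi * r0) + kf" using assms by (simp add: field_simps)
  finally show ?thesis .
qed

theorem proposition5p4:
  fixes kd r0 :: real
    and A :: complex
    and m :: "side \<Rightarrow> nat"
    and \<gamma> :: "side \<Rightarrow> nat \<Rightarrow> real"
    and N :: "real \<Rightarrow> nat"
    and l :: "real \<Rightarrow> side \<Rightarrow> nat \<Rightarrow> real"
  assumes "- sqrt 2 < kd" and "kd < 0"
    and "0 < r0"
    and "\<And>\<epsilon>. 1 \<le> m \<epsilon>"
    and "\<And>\<epsilon> i. 1 \<le> i \<Longrightarrow> i < m \<epsilon> \<Longrightarrow> 0 < \<gamma> \<epsilon> i \<and> \<gamma> \<epsilon> i < pi / 2 \<and> \<gamma> \<epsilon> i / pi \<in> \<rat>"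
    and "\<forall>\<^sub>F kf in at_right 0. double_spiral_table kd kf A r0 m \<gamma> (N kf) (l kf)"
  shows "\<exists>B. bounded B \<and> (\<forall>\<^sub>F kf in at_right 0. table kd kf r0 m \<gamma> (N kf) (l kf) \<subseteq> B)"
proof -
  define C where "C = 65 + 16 / \<bar>kd\<bar>"
  define K where "K = K4 m \<gamma>"
  \<comment> \<open>Bounds the exponent (rounds times \<open>K * h / r0\<close>) using
    \<open>h \<le> 2 * C * kf\<close> and rounds times \<open>kf\<close> at most
    \<open>1 / (2 * pi * r0) + 1\<close>. The factors \<open>kf\<close> cancel.\<close>
  define E where "E = (1 / (2 * pi * r0) + 1) * (K * (2 * C) / r0)"
  \<comment> \<open>The box reaches height 3 because
    \<open>1 + h \<le> 1 + 2 * C * kf \<le> 3\<close>.\<close>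
  define B where "B = cbox (Complex 0 (- 1/2)) (Complex 1 3) \<union> cball A (8 * r0 * exp E)"
  have angle: "\<And>\<epsilon> i. 1 \<le> i \<Longrightarrow> i < m \<epsilon> \<Longrightarrow> 0 < \<gamma> \<epsilon> i \<and> \<gamma> \<epsilon> i < pi / 2"
    using assms(5) by blast
  have "sqrt 2 \<le> 2" by (rule real_le_lsqrt) auto
  then have kd: "- 2 \<le> kd" using assms(1) by simp
  have C: "0 < C" by (simp add: C_def add_pos_nonneg)
  have K: "0 < K" unfolding K_def K4_def
    using angle by (intro add_pos_pos prod_pos) (auto intro: cos_gt_zero)
  \<comment> \<open>The three thresholds give, in turn, the location of the focusing arc, the bound
    \<open>C * kf\<close> on the optimal height, and a spiral width at most
    \<open>r0\<close>.\<close>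
  have ev: "\<forall>\<^sub>F kf in at_right 0. 0 < kf \<and> kf < min 1 (min (1 / C) (r0 / (2 * K * C)))"
    unfolding eventually_at_right_field using assms(3) C K
    by (intro exI[of _ "min 1 (min (1 / C) (r0 / (2 * K * C)))"]) auto
  have "\<forall>\<^sub>F kf in at_right 0. table kd kf r0 m \<gamma> (N kf) (l kf) \<subseteq> B"
    using assms(6) ev
  proof eventually_elim
    case (elim kf)
    define h where "h = opening_length r0 m \<gamma> (N kf)"
    from elim have kf: "0 < kf" "kf \<le> 1" and "kf < 1 / C" "kf < r0 / (2 * K * C)" by auto
    then have Ckf: "C * kf \<le> 1" and KCkf: "K * (2 * C * kf) \<le> r0"
      using C K by (auto simp: field_simps)
    have \<theta>: "0 < 2 * pi / real (N kf)" "2 * pi / real (N kf) < pi / 2"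
      and h_opt: "h_opt kd kf \<le> h" "h \<le> 2 * h_opt kd kf"
      using elim(1) unfolding double_spiral_table_def h_def by blast+
    note ho = h_opt_bounds[OF kd assms(2) kf, folded C_def, OF Ckf]
    have h: "0 < h" "h \<le> 2 * C * kf" using ho h_opt by auto
    have Kh: "K * h \<le> K * (2 * C * kf)" using h K by (intro mult_left_mono) auto
    have small: "K * h \<le> r0" using Kh KCkf by linarith
    have "real (rounds r0 kf) * (K * h / r0) \<le> real (rounds r0 kf) * (K * (2 * C * kf) / r0)"
      using divide_right_mono[OF Kh, of r0] assms(3) by (intro mult_left_mono) auto
    also have "\<dots> = (real (rounds r0 kf) * kf) * (K * (2 * C) / r0)" by simp
    also have "\<dots> \<le> E"
      unfolding E_def using rounds_mult_le[OF assms(3) kf(1)] kf K C assms(3)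
      by (intro mult_right_mono) auto
    finally have le: "8 * r0 * exp (real (rounds r0 kf) * (K * h / r0)) \<le> 8 * r0 * exp E"
      using assms(3) by simp
    have "spiral_piece r0 m \<gamma> (N kf) (l kf) \<epsilon> i \<subseteq> B"
      if i: "i \<in> {1..last_index kf r0 m (N kf) \<epsilon>}" for \<epsilon> i
      using order_trans[OF spirals_bound[OF assms(3) angle \<theta> elim(1) _ _ i, folded h_def K_def,
            OF _ _ h(1) small] subset_cball[OF le]]
      unfolding B_def by blast
    moreover have "bulk kd kf h \<subseteq> cbox (Complex 0 (- 1/2)) (Complex 1 (1 + h))"
      using kf h by (intro bulk_subset_box) auto
    moreover have "cbox (Complex 0 (- 1/2)) (Complex 1 (1 + h)) \<subseteq> B"
      using h Ckf by (auto simp: B_def in_cbox_complex_iff)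
    ultimately show ?case
      unfolding table_def h_def[symmetric] by blast
  qed
  moreover have "bounded B" by (simp add: B_def)
  ultimately show ?thesis by blast
qed

end
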